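(* Let $f\in\mathscr{S}^*_{\mathcal{R}}$ and let $f^{-1}(\omega)=\omega+\sum_{n=2}^{\infty}A_n\omega^n$ for all $\omega$ in some neighbourhood of the origin. Then $$|A_n|\leq\frac{\sqrt{2}-1}{n-1}\quad(\text{for } n=2,3,4)\qquad\text{and}\qquad |A_5|\leq\frac{69}{\sqrt{2}}-\frac{387}{8}.$$ The first three bounds (for $n=2,3,4$) are sharp, i.e. for each of them there is a function $f\in\mathscr{S}^*_{\mathcal{R}}$ for which equality holds.
   Context: $\mathbb{D}=\{z\in\mathbb{C}:|z|<1\}$. $\mathscr{A}$ is the class of functions $f$ analytic in $\mathbb{D}$ with $f(0)=0$, $f'(0)=1$. For analytic $F,G:\mathbb{D}\to\mathbb{C}$, $F\prec G$ (subordination) means that $F(z)=G(w(z))$ in $\mathbb{D}$ for some analytic $w:\mathbb{D}\to\mathbb{D}$ with $w(0)=0$. Let $k=\sqrt{2}+1$ and $$\varphi_{\mathcal{R}}(z)=1+\frac{z}{k}\left(\frac{k+z}{k-z}\right)=1+\frac1k z+\frac{2}{k^2}z^2+\frac{2}{k^3}z^3+\cdots.$$ The class $\mathscr{S}^*_{\mathcal{R}}$ is $\{f\in\mathscr{A}: zf'(z)/f(z)\prec\varphi_{\mathcal{R}}(z)\}$, where $zf'(z)/f(z)$ is given the value $1$ at $z=0$. $f^{-1}$ denotes the local inverse of $f$ near the origin with $f^{-1}(0)=0$. *)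

theory Defs
  imports "HOL-Complex_Analysis.Complex_Analysis"
begin

text \<open>
  Functions on the unit disc \<open>\<D>\<close> are total functions on \<^typ>\<open>complex\<close> of which only the
  values on \<open>\<D>\<close> matter.
\<close>

abbreviation unit_disc :: "complex set" ("\<D>") where
  "\<D> \<equiv> ball 0 1"

definition class_A :: "(complex \<Rightarrow> complex) set" where
  "class_A = {f. f holomorphic_on \<D> \<and> f 0 = 0 \<and> deriv f 0 = 1}"

definition subordinate :: "(complex \<Rightarrow> complex) \<Rightarrow> (complex \<Rightarrow> complex) \<Rightarrow> bool"
    (infix "\<prec>\<^sub>s" 50) where
  "F \<prec>\<^sub>s G \<longleftrightarrow> F holomorphic_on \<D> \<and> G holomorphic_on \<D> \<and>
     (\<exists>w. w holomorphic_on \<D> \<and> w ` \<D> \<subseteq> \<D> \<and> w 0 = 0 \<and> (\<forall>z\<in>\<D>. F z = G (w z)))"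

definition k_R :: real where
  "k_R = sqrt 2 + 1"

definition phi_R :: "complex \<Rightarrow> complex" where
  "phi_R z = 1 + z / of_real k_R * ((of_real k_R + z) / (of_real k_R - z))"

definition starlike_quotient :: "(complex \<Rightarrow> complex) \<Rightarrow> complex \<Rightarrow> complex" where
  "starlike_quotient f z = (if z = 0 then 1 else z * deriv f z / f z)"

text \<open>
  The quotient is only meaningful if \<open>f\<close> has no zero in \<open>\<D> - {0}\<close>. Since Isabelle sets
  \<open>x / 0 = 0\<close>, this is required explicitly.
\<close>

definition starlike_R :: "(complex \<Rightarrow> complex) set" where
  "starlike_R = {f \<in> class_A. (\<forall>z\<in>\<D> - {0}. f z \<noteq> 0) \<and> starlike_quotient f \<prec>\<^sub>s phi_R}"

text \<open>
  \<open>g\<close> agrees near the origin with the local inverse of \<open>f\<close>. The third condition excludes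
  other branches, i.e. values \<open>g \<omega>\<close> which are preimages of \<open>\<omega>\<close> far from the origin.
\<close>

definition local_inverse_at_0 :: "(complex \<Rightarrow> complex) \<Rightarrow> (complex \<Rightarrow> complex) \<Rightarrow> bool" where
  "local_inverse_at_0 f g \<longleftrightarrow> g 0 = 0 \<and>
     (\<forall>\<^sub>F \<omega> in nhds 0. g \<omega> \<in> \<D> \<and> f (g \<omega>) = \<omega>) \<and> (\<forall>\<^sub>F z in nhds 0. g (f z) = z)"

text \<open>
  \<open>f\<^sup>-\<^sup>1(\<omega>) = \<omega> + (\<Sum>n\<ge>2. A\<^sub>n \<omega>\<^sup>n)\<close> near the origin; the values \<open>A 0\<close> and \<open>A 1\<close> play no role.
\<close>

definition inverse_coeffs :: "(complex \<Rightarrow> complex) \<Rightarrow> (nat \<Rightarrow> complex) \<Rightarrow> bool" where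
  "inverse_coeffs f A \<longleftrightarrow> (\<exists>g. local_inverse_at_0 f g \<and>
     (\<forall>\<^sub>F \<omega> in nhds 0. (\<lambda>n. A (n + 2) * \<omega> ^ (n + 2)) sums (g \<omega> - \<omega>)))"

end

theory Submission
  imports Defs
begin

text \<open>
  Write \<open>l = 1 / k = \<surd>2 - 1\<close> and let \<open>w = c\<^sub>1 z + c\<^sub>2 z\<^sup>2 + \<dots>\<close> be the Schwarz function with
  \<open>z f' / f = \<phi> \<circ> w = P\<close>. Substituting the inverse \<open>g\<close> of \<open>f\<close> into \<open>z f' = f P\<close> and using
  \<open>f'(g) g' = 1\<close> eliminates \<open>f\<close> altogether: \<open>g(\<omega>) = \<omega> g'(\<omega>) P(g(\<omega>))\<close>. Comparing coefficients,
  this equation (\<open>fps_inverse_quotient_equation\<close>) determines the \<open>A\<^sub>n\<close> from the coefficients of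
  \<open>P\<close>. These in turn come from \<open>w\<close>, because \<open>\<phi>\<close> is a rational function that satisfies
  \<open>(1 - l z) (\<phi>(z) - 1) = l z (1 + l z)\<close>. The outcome (\<open>inverse_coeffs_formulas\<close>) is

  \<open>A\<^sub>2 = - l c\<^sub>1\<close>, \<open>A\<^sub>3 = - l/2 (c\<^sub>2 - l c\<^sub>1\<^sup>2)\<close>, \<open>A\<^sub>4 = - l/3 (c\<^sub>3 - 2 l c\<^sub>1 c\<^sub>2 - 2 l\<^sup>2 c\<^sub>1\<^sup>3)\<close>

  and a similar expression with five terms for \<open>A\<^sub>5\<close>.

  The first three bounds say that the functionals of the \<open>c\<^sub>n\<close> in these formulas are at most \<open>1\<close>
  in modulus. Multiplication by the bounded function \<open>w\<close> is a contraction of the Hardy space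
  \<open>H\<^sup>2\<close>, also after truncation to finitely many coefficients (\<open>bounded_multiplier_contraction\<close>).
  Applied to \<open>1 - l c\<^sub>1 z\<close> and to \<open>1 - 2 l c\<^sub>1 z - 2 l\<^sup>2 c\<^sub>1\<^sup>2 z\<^sup>2\<close>, polynomials chosen so that the
  functional in question appears as a coefficient of the product with \<open>w\<close>, it gives, for
  \<open>t = \<bar>c\<^sub>1\<bar>\<^sup>2 \<le> 1\<close>,

  \<open>t + \<bar>c\<^sub>2 - l c\<^sub>1\<^sup>2\<bar>\<^sup>2 \<le> 1 + l\<^sup>2 t\<close> and \<open>t + \<bar>c\<^sub>3 - 2 l c\<^sub>1 c\<^sub>2 - 2 l\<^sup>2 c\<^sub>1\<^sup>3\<bar>\<^sup>2 \<le> 1 + 4 l\<^sup>2 t + 4 l\<^sup>4 t\<^sup>2\<close>.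

  Since \<open>l\<^sup>2\<close> and \<open>4 l\<^sup>2 + 4 l\<^sup>4\<close> are less than \<open>1\<close>, the term \<open>t\<close> on the left absorbs the excess on
  the right. The constant claimed for \<open>A\<^sub>5\<close>, about \<open>0.4154\<close>, is large enough for the triangle
  inequality with \<open>\<bar>c\<^sub>n\<bar> \<le> 1\<close>, which gives about \<open>0.3977\<close>.

  For sharpness take \<open>w(z) = z\<^sup>n\<^sup>-\<^sup>1\<close>: then \<open>c\<^sub>n\<^sub>-\<^sub>1 = 1\<close> and all other coefficients vanish, so that
  \<open>A\<^sub>n = - l / (n - 1)\<close>. The corresponding \<open>f\<close> is elementary (\<open>starlike_R_with_power_schwarz\<close>).
\<close>

unbundle no vec_syntax and fps_syntax

section \<open>Coefficients of the inverse function\<close>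

text \<open>
  The chain rule for \<open>F \<circ> G = X\<close> gives \<open>(F' \<circ> G) G' = 1\<close>, and the substitution of \<open>G\<close> into
  \<open>X F' = F P\<close> gives \<open>G (F' \<circ> G) = X (P \<circ> G)\<close>. Multiplying the latter by \<open>G'\<close> removes \<open>F\<close>.
\<close>

lemma fps_inverse_quotient_equation:
  fixes F G P :: "complex fps"
  assumes inv: "F oo G = fps_X" and quot: "fps_X * fps_deriv F = F * P" and G0: "G $ 0 = 0"
  shows "G = fps_X * fps_deriv G * (P oo G)"
proof -
  have "(fps_X * fps_deriv F) oo G = (F * P) oo G"
    by (simp add: quot)
  then have "G * (fps_deriv F oo G) = fps_X * (P oo G)"
    using G0 by (simp add: fps_compose_mult_distrib inv)
  moreover have "(fps_deriv F oo G) * fps_deriv G = 1"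
    using fps_compose_deriv[OF G0, of F] by (simp add: inv)
  ultimately have "G * 1 = fps_X * (P oo G) * fps_deriv G"
    by (metis mult.assoc)
  then show ?thesis by (simp add: mult_ac)
qed

text \<open>
  The coefficient of \<open>X\<^sup>n\<^sup>+\<^sup>1\<close> in the equation contains \<open>G\<^sub>n\<^sub>+\<^sub>1\<close> on the left and \<open>(n + 1) G\<^sub>n\<^sub>+\<^sub>1\<close> on the
  right, while everything else involves only earlier coefficients of \<open>G\<close>; hence the \<open>G\<^sub>n\<close> can be
  computed one after the other.
\<close>

lemma fps_inverse_coeffs_of_quotient:
  fixes G P :: "complex fps"
  assumes eq: "G = fps_X * fps_deriv G * (P oo G)" and G0: "G $ 0 = 0" and G1: "G $ 1 = 1"
  shows "P $ 0 = 1"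
    and "G $ 2 = - (P $ 1)"
    and "G $ 3 = - (P $ 2) / 2 + 3 / 2 * (P $ 1) ^ 2"
    and "G $ 4 = - (P $ 3) / 3 + 2 * P $ 1 * P $ 2 - 8 / 3 * (P $ 1) ^ 3"
    and "G $ 5 = - (P $ 4) / 4 + 5 / 3 * P $ 1 * P $ 3 + 5 / 8 * (P $ 2) ^ 2
           - 25 / 4 * (P $ 1) ^ 2 * P $ 2 + 125 / 24 * (P $ 1) ^ 4"
proof -
  define Q where "Q = P oo G"
  have rec: "G $ Suc n = (\<Sum>j=0..n. of_nat (Suc j) * G $ Suc j * Q $ (n - j))" for n
  proof -
    have "G $ Suc n = (fps_X * (fps_deriv G * Q)) $ Suc n"
      using eq unfolding Q_def by (simp add: mult.assoc)
    also have "\<dots> = (fps_deriv G * Q) $ n"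
      by (simp add: fps_mult_fps_X_commute)
    finally show ?thesis
      by (simp add: fps_mult_nth)
  qed
  note unf = numeral_eq_Suc sum.atLeast0_atMost_Suc
  have G1': "G $ Suc 0 = 1" using G1 by simp
  have Q0: "Q $ 0 = P $ 0" by (simp add: Q_def fps_compose_nth)
  show P0: "P $ 0 = 1" using rec[of 0] Q0 G1' by simp
  have Q1: "Q $ 1 = P $ 1"
    by (simp add: Q_def fps_compose_nth G0 G1')
  have Q2: "Q $ 2 = P $ 1 * G $ 2 + P $ 2"
    by (simp add: Q_def fps_compose_nth G0 G1' unf fps_mult_nth)
  have Q3: "Q $ 3 = P $ 1 * G $ 3 + 2 * P $ 2 * G $ 2 + P $ 3"
    by (simp add: Q_def fps_compose_nth G0 G1' unf fps_mult_nth algebra_simps)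
  have Q4: "Q $ 4 = P $ 1 * G $ 4 + P $ 2 * (2 * G $ 3 + (G $ 2) ^ 2) + 3 * P $ 3 * G $ 2 + P $ 4"
    by (simp add: Q_def fps_compose_nth G0 G1' unf fps_mult_nth algebra_simps)
  have r2: "G $ 2 = Q $ 1 + 2 * G $ 2"
    using rec[of 1] Q0 P0 by (simp add: unf G1')
  have r3: "G $ 3 = Q $ 2 + 2 * G $ 2 * Q $ 1 + 3 * G $ 3"
    using rec[of 2] Q0 P0 by (simp add: unf G1')
  have r4: "G $ 4 = Q $ 3 + 2 * G $ 2 * Q $ 2 + 3 * G $ 3 * Q $ 1 + 4 * G $ 4"
    using rec[of 3] Q0 P0 by (simp add: unf G1')
  have r5: "G $ 5 = Q $ 4 + 2 * G $ 2 * Q $ 3 + 3 * G $ 3 * Q $ 2 + 4 * G $ 4 * Q $ 1 + 5 * G $ 5"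
    using rec[of 4] Q0 P0 by (simp add: unf G1')
  show G2: "G $ 2 = - (P $ 1)"
    using r2 Q1 by (simp add: eq_neg_iff_add_eq_0 add.commute)
  show G3: "G $ 3 = - (P $ 2) / 2 + 3 / 2 * (P $ 1) ^ 2"
    using r3 unfolding Q2 Q1 G2 by (simp add: field_simps power2_eq_square)
  have "G $ 4 * 3 = - (Q $ 3 + 2 * G $ 2 * Q $ 2 + 3 * G $ 3 * Q $ 1)"
    using r4 by (simp add: eq_neg_iff_add_eq_0 algebra_simps)
  from eq_divide_imp[OF _ this]
  have G4': "G $ 4 = - (Q $ 3 + 2 * G $ 2 * Q $ 2 + 3 * G $ 3 * Q $ 1) / 3" by simp
  show G4: "G $ 4 = - (P $ 3) / 3 + 2 * P $ 1 * P $ 2 - 8 / 3 * (P $ 1) ^ 3"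
    unfolding G4' Q3 Q2 Q1 G3 G2 by (simp add: field_simps power2_eq_square power3_eq_cube)
  have "G $ 5 * 4 = - (Q $ 4 + 2 * G $ 2 * Q $ 3 + 3 * G $ 3 * Q $ 2 + 4 * G $ 4 * Q $ 1)"
    using r5 by (simp add: eq_neg_iff_add_eq_0 algebra_simps)
  from eq_divide_imp[OF _ this]
  have G5': "G $ 5 = - (Q $ 4 + 2 * G $ 2 * Q $ 3 + 3 * G $ 3 * Q $ 2 + 4 * G $ 4 * Q $ 1) / 4" by simp
  show "G $ 5 = - (P $ 4) / 4 + 5 / 3 * P $ 1 * P $ 3 + 5 / 8 * (P $ 2) ^ 2
           - 25 / 4 * (P $ 1) ^ 2 * P $ 2 + 125 / 24 * (P $ 1) ^ 4"
    unfolding G5' Q4 Q3 Q2 Q1 G4 G3 G2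
    by (simp add: field_simps power2_eq_square power3_eq_cube power4_eq_xxxx)
qed

text \<open>
  The equation is the closed form of \<open>\<phi>\<close> with its denominator cleared. As \<open>W\<close> has no constant
  term, the product \<open>W (P - 1)\<close> makes it a recursion for the coefficients of \<open>P\<close>.
\<close>

lemma fps_quotient_coeffs_of_schwarz:
  fixes P W :: "complex fps" and l :: complex
  assumes eq: "P - 1 = fps_const l * W * (P - 1) + fps_const l * W + fps_const (l^2) * W ^ 2"
    and W0: "W $ 0 = 0"
  shows "P $ 1 = l * W $ 1"
    and "P $ 2 = l * W $ 2 + 2 * l^2 * (W $ 1) ^ 2"
    and "P $ 3 = l * W $ 3 + 4 * l^2 * W $ 1 * W $ 2 + 2 * l^3 * (W $ 1) ^ 3"
    and "P $ 4 = l * W $ 4 + 2 * l^2 * (2 * W $ 1 * W $ 3 + (W $ 2) ^ 2)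
           + 6 * l^3 * (W $ 1) ^ 2 * W $ 2 + 2 * l^4 * (W $ 1) ^ 4"
proof -
  define R where "R = P - 1"
  have PR: "P $ n = R $ n" if "n > 0" for n
    using that by (simp add: R_def)
  have rec: "R $ n = l * (W * R) $ n + l * W $ n + l^2 * (W * W) $ n" for n
  proof -
    have "R $ n = (fps_const l * (W * R) + fps_const l * W + fps_const (l^2) * (W * W)) $ n"
      using eq unfolding R_def by (simp add: mult.assoc power2_eq_square)
    then show ?thesis by simp
  qed
  note unf = numeral_eq_Suc sum.atLeast0_atMost_Suc fps_mult_nth
  have R0: "R $ 0 = 0" using rec[of 0] W0 by simp
  have R1: "R $ 1 = l * W $ 1"
    using rec[of 1] by (simp add: unf W0 R0)
  have "R $ 2 = l * (W $ 1 * R $ 1) + l * W $ 2 + l^2 * (W $ 1 * W $ 1)"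
    using rec[of 2] by (simp add: unf W0 R0)
  then have R2: "R $ 2 = l * W $ 2 + 2 * l^2 * (W $ 1) ^ 2"
    unfolding R1 by (simp add: algebra_simps power2_eq_square)
  have "R $ 3 = l * (W $ 1 * R $ 2 + W $ 2 * R $ 1) + l * W $ 3 + l^2 * (2 * W $ 1 * W $ 2)"
    using rec[of 3] by (simp add: unf W0 R0 algebra_simps)
  then have R3: "R $ 3 = l * W $ 3 + 4 * l^2 * W $ 1 * W $ 2 + 2 * l^3 * (W $ 1) ^ 3"
    unfolding R1 R2 by (simp add: algebra_simps power2_eq_square power3_eq_cube)
  have "R $ 4 = l * (W $ 1 * R $ 3 + W $ 2 * R $ 2 + W $ 3 * R $ 1) + l * W $ 4
         + l^2 * (2 * W $ 1 * W $ 3 + (W $ 2) ^ 2)"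
    using rec[of 4] by (simp add: unf W0 R0 algebra_simps)
  then have R4: "R $ 4 = l * W $ 4 + 2 * l^2 * (2 * W $ 1 * W $ 3 + (W $ 2) ^ 2)
           + 6 * l^3 * (W $ 1) ^ 2 * W $ 2 + 2 * l^4 * (W $ 1) ^ 4"
    unfolding R1 R2 R3 by (simp add: algebra_simps power2_eq_square power3_eq_cube power4_eq_xxxx)
  show "P $ 1 = l * W $ 1"
    and "P $ 2 = l * W $ 2 + 2 * l^2 * (W $ 1) ^ 2"
    and "P $ 3 = l * W $ 3 + 4 * l^2 * W $ 1 * W $ 2 + 2 * l^3 * (W $ 1) ^ 3"
    and "P $ 4 = l * W $ 4 + 2 * l^2 * (2 * W $ 1 * W $ 3 + (W $ 2) ^ 2)
           + 6 * l^3 * (W $ 1) ^ 2 * W $ 2 + 2 * l^4 * (W $ 1) ^ 4"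
    using R1 R2 R3 R4 by (simp_all add: PR)
qed

section \<open>Multiplication by a bounded function\<close>

text \<open>
  Cauchy's formula for the \<open>n\<close>-th Taylor coefficient: on the circle \<open>\<bar>z\<bar> = r\<close> the conjugate of
  \<open>z\<^sup>n\<close> equals \<open>r\<^sup>2\<^sup>n / z\<^sup>n\<close>.
\<close>

lemma circle_integral_cnj_power:
  assumes hol: "h holomorphic_on \<D>" and H: "h has_fps_expansion H" and r: "0 < r" "r < 1"
  shows "((\<lambda>t. h (of_real r * cis t) * cnj ((of_real r * cis t) ^ n)) has_integral
           of_real (2 * pi * r ^ (2 * n)) * H $ n) {0..2 * pi}"
proof -
  have c: "continuous_on (cball 0 r) h" and b: "h holomorphic_on ball 0 r"
    using r by (auto intro!: holomorphic_on_imp_continuous_on holomorphic_on_subset[OF hol])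
  have "((\<lambda>u. h u / (u - 0) ^ Suc n) has_contour_integral
          (2 * pi * \<i>) / fact n * (deriv ^^ n) h 0) (part_circlepath 0 r 0 (2 * pi))"
    using Cauchy_has_contour_integral_higher_derivative_circlepath[OF c b, of 0 n] r
    by (simp add: circlepath_def)
  then have "((\<lambda>t. h (0 + r * cis t) / (0 + r * cis t - 0) ^ Suc n * r * \<i> * cis t) has_integral
          (2 * pi * \<i>) / fact n * (deriv ^^ n) h 0) {0..2 * pi}"
    by (subst (asm) has_contour_integral_part_circlepath_iff) auto
  then have "((\<lambda>t. (of_real (r ^ (2 * n)) / \<i>) *
                (h (0 + r * cis t) / (0 + r * cis t - 0) ^ Suc n * r * \<i> * cis t)) has_integral
          (of_real (r ^ (2 * n)) / \<i>) * ((2 * pi * \<i>) / fact n * (deriv ^^ n) h 0)) {0..2 * pi}"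
    by (rule has_integral_mult_right)
  moreover have "(of_real (r ^ (2 * n)) / \<i>) * ((2 * pi * \<i>) / fact n * (deriv ^^ n) h 0) =
      of_real (2 * pi * r ^ (2 * n)) * H $ n"
    by (simp add: fps_nth_fps_expansion[OF H] field_simps)
  moreover have "(of_real (r ^ (2 * n)) / \<i>) *
                (h (0 + r * cis t) / (0 + r * cis t - 0) ^ Suc n * r * \<i> * cis t) =
       h (of_real r * cis t) * cnj ((of_real r * cis t) ^ n)" for t
  proof -
    have "of_real (r ^ (2 * n)) = (of_real r * cis t) ^ n * cnj ((of_real r * cis t) ^ n)"
      using complex_norm_square[of "(of_real r * cis t) ^ n"] r
      by (simp add: norm_mult norm_power power_mult power_mult_distrib mult.commute[of 2 n])
    then show ?thesis using r by (simp add: field_simps)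
  qed
  ultimately show ?thesis by (simp only:)
qed

lemma circle_integral_cnj_polynomial:
  fixes s :: "nat \<Rightarrow> complex"
  assumes hol: "h holomorphic_on \<D>" and H: "h has_fps_expansion H" and r: "0 < r" "r < 1"
  shows "((\<lambda>t. h (of_real r * cis t) * cnj (\<Sum>n<N. s n * (of_real r * cis t) ^ n)) has_integral
           of_real (2 * pi) * (\<Sum>n<N. H $ n * cnj (s n) * of_real (r ^ (2 * n)))) {0..2 * pi}"
proof -
  have "((\<lambda>t. \<Sum>n<N. cnj (s n) * (h (of_real r * cis t) * cnj ((of_real r * cis t) ^ n))) has_integral
           (\<Sum>n<N. cnj (s n) * (of_real (2 * pi * r ^ (2 * n)) * H $ n))) {0..2 * pi}"
    by (intro has_integral_sum has_integral_mult_right circle_integral_cnj_power assms) auto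
  then show ?thesis
    by (simp add: sum_distrib_left mult_ac)
qed

lemma has_fps_expansion_polynomial:
  fixes s :: "nat \<Rightarrow> complex"
  shows "(\<lambda>z. \<Sum>n<N. s n * z ^ n) has_fps_expansion Abs_fps (\<lambda>n. if n < N then s n else 0)"
proof -
  have "(\<lambda>z. \<Sum>n<N. s n * z ^ n) has_fps_expansion (\<Sum>n<N. fps_const (s n) * fps_X ^ n)"
    by (intro fps_expansion_intros)
  also have "(\<Sum>n<N. fps_const (s n) * fps_X ^ n) = Abs_fps (\<lambda>n. if n < N then s n else 0)"
    by (simp add: fps_eq_iff fps_sum_nth if_distrib if_distribR cong: if_cong)
  finally show ?thesis .
qed

lemma parseval_polynomial:
  fixes s :: "nat \<Rightarrow> complex"
  assumes r: "0 < r" "r < 1"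
  shows "((\<lambda>t. (cmod (\<Sum>n<N. s n * (of_real r * cis t) ^ n))\<^sup>2) has_integral
           2 * pi * (\<Sum>n<N. (cmod (s n))\<^sup>2 * r ^ (2 * n))) {0..2 * pi}"
proof -
  define S where "S = Abs_fps (\<lambda>n. if n < N then s n else 0)"
  have S: "(\<lambda>z. \<Sum>n<N. s n * z ^ n) has_fps_expansion S"
    unfolding S_def by (rule has_fps_expansion_polynomial)
  have "((\<lambda>t. (\<Sum>n<N. s n * (of_real r * cis t) ^ n) * cnj (\<Sum>n<N. s n * (of_real r * cis t) ^ n))
      has_integral of_real (2 * pi) * (\<Sum>n<N. S $ n * cnj (s n) * of_real (r ^ (2 * n)))) {0..2 * pi}"
    by (rule circle_integral_cnj_polynomial[OF _ S r]) (intro holomorphic_intros)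
  also have "of_real (2 * pi) * (\<Sum>n<N. S $ n * cnj (s n) * of_real (r ^ (2 * n))) =
     complex_of_real (2 * pi * (\<Sum>n<N. (cmod (s n))\<^sup>2 * r ^ (2 * n)))"
    by (simp add: S_def complex_norm_square del: of_real_power)
  finally have "((\<lambda>t. complex_of_real ((cmod (\<Sum>n<N. s n * (of_real r * cis t) ^ n))\<^sup>2)) has_integral
           complex_of_real (2 * pi * (\<Sum>n<N. (cmod (s n))\<^sup>2 * r ^ (2 * n)))) {0..2 * pi}"
    by (simp only: complex_norm_square)
  from has_integral_linear[OF this bounded_linear_Re] show ?thesis
    by (simp only: o_def Re_complex_of_real)
qed

text \<open>
  Multiplication by \<open>w\<close> does not increase the \<open>H\<^sup>2\<close>-norm of the polynomial \<open>p\<close> with coefficients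
  \<open>v\<close>. If \<open>q\<close> is the truncation of \<open>p w\<close> to degree less than \<open>N\<close>, then the mean of \<open>p w q\<^sup>*\<close> over
  the circle of radius \<open>r\<close> (with \<open>q\<^sup>*\<close> the conjugate of \<open>q\<close>) is the squared norm of \<open>q\<close>; since
  \<open>\<bar>w\<bar> \<le> 1\<close>, it is at most the mean of \<open>(\<bar>p\<bar>\<^sup>2 + \<bar>q\<bar>\<^sup>2) / 2\<close>. Cancelling half the norm of \<open>q\<close>
  bounds it by that of \<open>p\<close>. Working with the truncation keeps all sums finite, which makes the limit
  \<open>r \<rightarrow> 1\<close> immediate.
\<close>

lemma bounded_multiplier_contraction:
  fixes v :: "nat \<Rightarrow> complex"
  assumes hol: "w holomorphic_on \<D>" and le1: "\<And>z. z \<in> \<D> \<Longrightarrow> cmod (w z) \<le> 1"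
    and W: "w has_fps_expansion W"
  shows "(\<Sum>n<N. (cmod (\<Sum>j\<le>n. v j * W $ (n - j)))\<^sup>2) \<le> (\<Sum>n<N. (cmod (v n))\<^sup>2)"
proof -
  define p where "p z = (\<Sum>n<N. v n * z ^ n)" for z
  define s where "s n = (\<Sum>j\<le>n. v j * W $ (n - j))" for n
  define q where "q z = (\<Sum>n<N. s n * z ^ n)" for z
  define V where "V = Abs_fps (\<lambda>n. if n < N then v n else 0)"
  have V: "p has_fps_expansion V"
    unfolding V_def p_def by (rule has_fps_expansion_polynomial)
  have ph: "p holomorphic_on \<D>" unfolding p_def by (intro holomorphic_intros)
  have VW: "(V * W) $ n = s n" if "n < N" for n
    using that by (auto simp: fps_mult_nth s_def V_def atMost_atLeast0 intro!: sum.cong)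
  have key: "(\<Sum>n<N. (cmod (s n))\<^sup>2 * r ^ (2 * n)) \<le> (\<Sum>n<N. (cmod (v n))\<^sup>2 * r ^ (2 * n))"
    if r: "0 < r" "r < 1" for r
  proof -
    let ?z = "\<lambda>t. complex_of_real r * cis t"
    let ?S = "\<Sum>n<N. (cmod (s n))\<^sup>2 * r ^ (2 * n)" and ?V = "\<Sum>n<N. (cmod (v n))\<^sup>2 * r ^ (2 * n)"
    have "((\<lambda>t. p (?z t) * w (?z t) * cnj (q (?z t))) has_integral
        of_real (2 * pi) * (\<Sum>n<N. (V * W) $ n * cnj (s n) * of_real (r ^ (2 * n)))) {0..2 * pi}"
      unfolding q_def
      by (rule circle_integral_cnj_polynomial[OF _ _ r])
         (intro holomorphic_intros ph hol has_fps_expansion_mult V W)+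
    also have "of_real (2 * pi) * (\<Sum>n<N. (V * W) $ n * cnj (s n) * of_real (r ^ (2 * n)))
        = complex_of_real (2 * pi * ?S)"
      by (simp add: VW complex_norm_square del: of_real_power)
    finally have I: "((\<lambda>t. p (?z t) * w (?z t) * cnj (q (?z t))) has_integral
        complex_of_real (2 * pi * ?S)) {0..2 * pi}" .
    have J: "((\<lambda>t. ((cmod (p (?z t)))\<^sup>2 + (cmod (q (?z t)))\<^sup>2) / 2) has_integral
        (2 * pi * ?V + 2 * pi * ?S) / 2) {0..2 * pi}"
      unfolding p_def q_def
      by (intro has_integral_divide has_integral_add parseval_polynomial r)
    have "cmod (p (?z t) * w (?z t) * cnj (q (?z t))) \<le> ((cmod (p (?z t)))\<^sup>2 + (cmod (q (?z t)))\<^sup>2) / 2"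
      for t
    proof -
      have "cmod (w (?z t)) \<le> 1" using le1[of "?z t"] r by (simp add: norm_mult)
      then have "cmod (p (?z t)) * cmod (w (?z t)) * cmod (q (?z t)) \<le> cmod (p (?z t)) * 1 * cmod (q (?z t))"
        by (intro mult_right_mono mult_left_mono) auto
      also have "\<dots> \<le> ((cmod (p (?z t)))\<^sup>2 + (cmod (q (?z t)))\<^sup>2) / 2"
        using sum_squares_bound[of "cmod (p (?z t))" "cmod (q (?z t))"] by simp
      finally show ?thesis by (simp add: norm_mult)
    qed
    then have "cmod (complex_of_real (2 * pi * ?S)) \<le> (2 * pi * ?V + 2 * pi * ?S) / 2"
      using integral_norm_bound_integral[OF has_integral_integrable[OF I] has_integral_integrable[OF J]]
      by (simp only: integral_unique[OF I] integral_unique[OF J])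
    moreover have "x \<le> y" if "\<bar>x\<bar> \<le> (y + x) / 2" for x y :: real
      using order_trans[OF abs_ge_self that] by simp
    ultimately have "2 * pi * ?S \<le> 2 * pi * ?V"
      unfolding norm_of_real by blast
    then show ?thesis by simp
  qed
  have lim: "((\<lambda>r. \<Sum>n<N. (cmod (u n))\<^sup>2 * r ^ (2 * n)) \<longlongrightarrow> (\<Sum>n<N. (cmod (u n))\<^sup>2 * 1 ^ (2 * n))) (at_left (1::real))"
    for u :: "nat \<Rightarrow> complex"
    by (intro tendsto_intros)
  have "eventually (\<lambda>r. r \<in> {0<..<1}) (at_left (1::real))"
    by (rule eventually_at_left_real) simp
  then have "eventually (\<lambda>r. (\<Sum>n<N. (cmod (s n))\<^sup>2 * r ^ (2 * n)) \<le> (\<Sum>n<N. (cmod (v n))\<^sup>2 * r ^ (2 * n)))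
       (at_left 1)"
    by eventually_elim (use key in auto)
  from tendsto_le[OF _ lim lim this] show ?thesis by (simp add: s_def)
qed

section \<open>Coefficient functionals of Schwarz functions\<close>

text \<open>
  The contraction property for the polynomial \<open>1 + a z + b z\<^sup>2\<close>. The coefficients of the product with
  \<open>w\<close> start at \<open>z\<close>, as \<open>w 0 = 0\<close>.
\<close>

lemma schwarz_coeffs_contraction:
  fixes a b :: complex
  assumes w: "w holomorphic_on \<D>" "w ` \<D> \<subseteq> \<D>" "w 0 = 0" and W: "w has_fps_expansion W"
  shows "(cmod (W $ 1))\<^sup>2 + (cmod (W $ 2 + a * W $ 1))\<^sup>2 + (cmod (W $ 3 + a * W $ 2 + b * W $ 1))\<^sup>2
    \<le> 1 + (cmod a)\<^sup>2 + (cmod b)\<^sup>2"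
proof -
  define v :: "nat \<Rightarrow> complex" where "v = (\<lambda>n. [1, a, b, 0] ! n)"
  have v: "v 0 = 1" "v (Suc 0) = a" "v (Suc (Suc 0)) = b" "v (Suc (Suc (Suc 0))) = 0"
    by (simp_all add: v_def)
  have le1: "cmod (w z) \<le> 1" if "z \<in> \<D>" for z
    using w(2) that by (force simp: image_subset_iff)
  have W0: "W $ 0 = 0"
    using has_fps_expansion_imp_0_eq_fps_nth_0[OF W] w(3) by simp
  show ?thesis
    using bounded_multiplier_contraction[OF w(1) le1 W, of v 4]
    by (simp add: numeral_eq_Suc v W0 add_ac)
qed

lemma schwarz_coeff_le_1:
  assumes w: "w holomorphic_on \<D>" "w ` \<D> \<subseteq> \<D>" and W: "w has_fps_expansion W"
  shows "cmod (W $ n) \<le> 1"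
proof -
  define v :: "nat \<Rightarrow> complex" where "v j = (if j = 0 then 1 else 0)" for j
  have le1: "cmod (w z) \<le> 1" if "z \<in> \<D>" for z
    using w(2) that by (force simp: image_subset_iff)
  have "(\<Sum>j\<le>m. v j * W $ (m - j)) = W $ m" for m
    by (subst sum.remove[of _ 0]) (auto simp: v_def intro!: sum.neutral)
  moreover have "(\<Sum>m<Suc n. (cmod (v m))\<^sup>2) = 1"
    by (subst sum.remove[of _ 0]) (auto simp: v_def intro!: sum.neutral)
  ultimately have "(\<Sum>m<Suc n. (cmod (W $ m))\<^sup>2) \<le> 1"
    using bounded_multiplier_contraction[OF w(1) le1 W, of v "Suc n"] by simp
  moreover have "(cmod (W $ n))\<^sup>2 \<le> (\<Sum>m<Suc n. (cmod (W $ m))\<^sup>2)"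
    by (rule member_le_sum) auto
  ultimately show ?thesis by (auto intro: power2_le_imp_le[of _ 1])
qed

text \<open>
  With \<open>a = - l c\<^sub>1\<close> the functional is the second coefficient of \<open>(1 + a z) w\<close>, and \<open>\<bar>a\<bar>\<^sup>2 = l\<^sup>2 \<bar>c\<^sub>1\<bar>\<^sup>2\<close>
  is compensated by the first coefficient \<open>c\<^sub>1\<close>.
\<close>

lemma schwarz_functional_2:
  fixes l :: real
  assumes w: "w holomorphic_on \<D>" "w ` \<D> \<subseteq> \<D>" "w 0 = 0" and W: "w has_fps_expansion W"
    and l: "\<bar>l\<bar> \<le> 1"
  shows "cmod (W $ 2 - of_real l * (W $ 1) ^ 2) \<le> 1"
proof -
  define t where "t = (cmod (W $ 1))\<^sup>2"
  have t: "0 \<le> t" by (simp add: t_def)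
  have "l\<^sup>2 \<le> 1" using l by (simp add: abs_square_le_1)
  then have "l\<^sup>2 * t \<le> t" using t mult_right_mono by fastforce
  moreover have "t + (cmod (W $ 2 - of_real l * (W $ 1) ^ 2))\<^sup>2 \<le> 1 + l\<^sup>2 * t"
  proof -
    define a where "a = - of_real l * W $ 1"
    have a2: "(cmod a)\<^sup>2 = l\<^sup>2 * t"
      by (simp add: a_def t_def norm_mult power_mult_distrib)
    have eq: "W $ 2 - of_real l * (W $ 1) ^ 2 = W $ 2 + a * W $ 1"
      by (simp add: a_def power2_eq_square)
    have "t + (cmod (W $ 2 - of_real l * (W $ 1) ^ 2))\<^sup>2
        \<le> t + (cmod (W $ 2 + a * W $ 1))\<^sup>2 + (cmod (W $ 3 + a * W $ 2 + 0 * W $ 1))\<^sup>2"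
      unfolding eq by simp
    also have "\<dots> \<le> 1 + (cmod a)\<^sup>2 + (cmod 0)\<^sup>2"
      unfolding t_def by (rule schwarz_coeffs_contraction[OF w W])
    finally show ?thesis by (simp add: a2)
  qed
  ultimately have "(cmod (W $ 2 - of_real l * (W $ 1) ^ 2))\<^sup>2 \<le> 1" by linarith
  then show ?thesis by (auto intro: power2_le_imp_le[of _ 1])
qed

text \<open>
  A case of the Prokhorov--Szynal inequality for \<open>\<bar>c\<^sub>3 + \<mu> c\<^sub>1 c\<^sub>2 + \<nu> c\<^sub>1\<^sup>3\<bar>\<close>. It has a short proof
  because for these parameters \<open>\<bar>\<mu>\<bar>\<^sup>2 + \<bar>\<nu>\<bar>\<^sup>2 \<le> 1\<close>, so the squared norm of the
  polynomial \<open>1 + \<mu> c\<^sub>1 z + \<nu> c\<^sub>1\<^sup>2 z\<^sup>2\<close> is at most \<open>1 + \<bar>c\<^sub>1\<bar>\<^sup>2\<close>, and the first coefficient \<open>c\<^sub>1\<close>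
  of its product with \<open>w\<close> accounts for the excess.
\<close>

lemma schwarz_functional_3:
  fixes l :: real
  assumes w: "w holomorphic_on \<D>" "w ` \<D> \<subseteq> \<D>" "w 0 = 0" and W: "w has_fps_expansion W"
    and l: "4 * l ^ 2 + 4 * l ^ 4 \<le> 1"
  shows "cmod (W $ 3 - 2 * of_real l * W $ 1 * W $ 2 - 2 * of_real l ^ 2 * (W $ 1) ^ 3) \<le> 1"
proof -
  define t where "t = (cmod (W $ 1))\<^sup>2"
  define y where "y = W $ 3 - 2 * of_real l * W $ 1 * W $ 2 - 2 * of_real l ^ 2 * (W $ 1) ^ 3"
  have t: "0 \<le> t" by (simp add: t_def)
  have t1: "t \<le> 1" using schwarz_coeff_le_1[OF w(1,2) W, of 1] by (simp add: t_def power_le_one)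
  define a b where "a = - 2 * of_real l * W $ 1" and "b = - 2 * of_real l ^ 2 * (W $ 1) ^ 2"
  have "W $ 3 + a * W $ 2 + b * W $ 1 = y"
    by (simp add: y_def a_def b_def power2_eq_square power3_eq_cube)
  then have "t + (cmod y)\<^sup>2
      \<le> t + (cmod (W $ 2 + a * W $ 1))\<^sup>2 + (cmod (W $ 3 + a * W $ 2 + b * W $ 1))\<^sup>2"
    by simp
  also have "\<dots> \<le> 1 + (cmod a)\<^sup>2 + (cmod b)\<^sup>2"
    unfolding t_def by (rule schwarz_coeffs_contraction[OF w W])
  also have "(cmod a)\<^sup>2 = 4 * l ^ 2 * t"
    by (simp add: a_def t_def norm_mult power_mult_distrib)
  also have "(cmod b)\<^sup>2 = 4 * l ^ 4 * t\<^sup>2"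
    by (simp add: b_def t_def norm_mult norm_power power_mult_distrib flip: power_mult)
  finally have "t + (cmod y)\<^sup>2 \<le> 1 + 4 * l ^ 2 * t + 4 * l ^ 4 * t\<^sup>2" .
  moreover have "4 * l ^ 4 * t\<^sup>2 \<le> 4 * l ^ 4 * t"
    using t t1 by (intro mult_left_mono) (auto simp: power2_eq_square mult_left_le)
  moreover have "(4 * l ^ 2 + 4 * l ^ 4) * t \<le> 1 * t"
    using l t by (rule mult_right_mono)
  ultimately have "(cmod y)\<^sup>2 \<le> 1" by (simp add: algebra_simps)
  then show ?thesis unfolding y_def by (auto intro: power2_le_imp_le[of _ 1])
qed

text \<open>
  Since \<open>l\<close> is a root of \<open>x\<^sup>2 + 2 x - 1\<close>, its powers reduce to linear expressions, and polynomial
  inequalities in \<open>l\<close> become comparisons of \<open>l\<close> with rational numbers. The lower bound is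
  close enough to \<open>l\<close> for the estimate of the fifth coefficient, which amounts to
  \<open>l \<ge> 173 / 418 = 0.41387\<dots>\<close>.
\<close>

lemma silver_powers:
  fixes l :: real
  assumes "l = sqrt 2 - 1"
  shows "l ^ 2 = 1 - 2 * l" "l ^ 3 = 5 * l - 2" "l ^ 4 = 5 - 12 * l"
    "207 / 500 < l" "l < 5 / 12"
proof -
  have s: "sqrt 2 * sqrt 2 = 2" by simp
  show l2: "l ^ 2 = 1 - 2 * l" unfolding assms power2_eq_square using s by (simp add: algebra_simps)
  have ll: "l * l = 1 - 2 * l" using l2 by (simp add: power2_eq_square)
  have "l ^ 3 = l * (l * l)" by (simp add: power3_eq_cube)
  also have "\<dots> = l * (1 - 2 * l)" by (simp only: ll)
  also have "\<dots> = l - 2 * (l * l)" by (simp add: algebra_simps)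
  finally show "l ^ 3 = 5 * l - 2" by (simp add: ll)
  have "l ^ 4 = (l * l) * (l * l)" by (simp add: power4_eq_xxxx)
  also have "\<dots> = (1 - 2 * l) * (1 - 2 * l)" by (simp only: ll)
  also have "\<dots> = 1 - 4 * l + 4 * (l * l)" by (simp add: algebra_simps)
  finally show "l ^ 4 = 5 - 12 * l" by (simp add: ll)
  have "707/500 < sqrt 2" by (rule real_less_rsqrt) (simp add: power2_eq_square)
  moreover have "sqrt 2 < 17/12" by (rule real_less_lsqrt) (auto simp: power2_eq_square)
  ultimately show "207 / 500 < l" "l < 5 / 12" by (auto simp: assms)
qed

text \<open>
  The functional in the formula for \<open>A\<^sub>5\<close>. Estimating it term by term loses the cancellation
  between the summands, which the constant in the bound for \<open>A\<^sub>5\<close> leaves room for.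
\<close>

lemma schwarz_functional_4:
  fixes l :: real
  assumes w: "w holomorphic_on \<D>" "w ` \<D> \<subseteq> \<D>" and W: "w has_fps_expansion W"
    and l: "0 \<le> l"
  shows "cmod (W $ 4 - 8 / 3 * of_real l * W $ 1 * W $ 3 - 1 / 2 * of_real l * (W $ 2) ^ 2
           - 17 / 3 * of_real l ^ 2 * (W $ 1) ^ 2 * W $ 2 + 47 / 6 * of_real l ^ 3 * (W $ 1) ^ 4)
     \<le> 1 + 8 / 3 * l + 1 / 2 * l + 17 / 3 * l ^ 2 + 47 / 6 * l ^ 3"
proof -
  have c: "cmod (W $ n) \<le> 1" for n by (rule schwarz_coeff_le_1[OF w W])
  have scaled: "cmod (of_real r * x) \<le> r" if "0 \<le> r" "cmod x \<le> 1" for r :: real and x :: complex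
    using that by (simp add: norm_mult mult_left_le)
  have diff: "cmod (x - y) \<le> r + s" if "cmod x \<le> r" "cmod y \<le> s" for x y r s
    using norm_triangle_ineq4[of x y] that by linarith
  have tri: "cmod (x1 - x2 - x3 - x4 + x5) \<le> r1 + r2 + r3 + r4 + r5"
    if "cmod x1 \<le> r1" "cmod x2 \<le> r2" "cmod x3 \<le> r3" "cmod x4 \<le> r4" "cmod x5 \<le> r5"
    for x1 x2 x3 x4 x5 r1 r2 r3 r4 r5
    using that by (intro norm_triangle_mono diff)
  have m: "cmod (x * y) \<le> 1" if "cmod x \<le> 1" "cmod y \<le> 1" for x y :: complex
    using that by (simp add: norm_mult mult_le_one)
  have q: "cmod (x ^ n) \<le> 1" if "cmod x \<le> 1" for x :: complex and n
    using that by (simp add: norm_power power_le_one)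
  have "cmod (W $ 4 - of_real (8 / 3 * l) * (W $ 1 * W $ 3) - of_real (1 / 2 * l) * (W $ 2) ^ 2
         - of_real (17 / 3 * l ^ 2) * ((W $ 1) ^ 2 * W $ 2) + of_real (47 / 6 * l ^ 3) * (W $ 1) ^ 4)
     \<le> 1 + 8 / 3 * l + 1 / 2 * l + 17 / 3 * l ^ 2 + 47 / 6 * l ^ 3"
    by (intro tri scaled c m q) (use l in auto)
  then show ?thesis by (simp add: mult.assoc)
qed

lemma fifth_coefficient_constant:
  fixes l :: real
  assumes l: "l = sqrt 2 - 1"
  shows "l / 4 * (1 + 8 / 3 * l + 1 / 2 * l + 17 / 3 * l ^ 2 + 47 / 6 * l ^ 3) \<le> 69 / sqrt 2 - 387 / 8"
proof -
  note p = silver_powers[OF l]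
  have "l / 4 * (1 + 8 / 3 * l + 1 / 2 * l + 17 / 3 * l ^ 2 + 47 / 6 * l ^ 3)
      = (l + 19 / 6 * l ^ 2 + 17 / 3 * l ^ 3 + 47 / 6 * l ^ 4) / 4"
    by (simp add: algebra_simps power2_eq_square power3_eq_cube power4_eq_xxxx)
  also have "\<dots> = (31 - 71 * l) / 4"
    unfolding p(1,2,3) by (simp add: field_simps)
  also have "\<dots> \<le> 69 / 2 * (l + 1) - 387 / 8"
    using p(4) by (simp add: field_simps)
  also have "69 / 2 * (l + 1) = 69 / sqrt 2"
    by (simp add: l real_div_sqrt field_simps)
  finally show ?thesis by simp
qed

section \<open>From the subordination to the coefficients\<close>

lemma one_over_k_R: "complex_of_real (sqrt 2 - 1) * complex_of_real k_R = 1"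
proof -
  have "(sqrt 2 - 1) * k_R = 1" by (simp add: k_R_def algebra_simps)
  then show ?thesis by (simp only: of_real_mult[symmetric] of_real_1)
qed

lemma k_R_not_in_disc: "z \<in> \<D> \<Longrightarrow> complex_of_real k_R - z \<noteq> 0"
proof
  assume "z \<in> \<D>" "complex_of_real k_R - z = 0"
  then have "z = complex_of_real k_R" "cmod z < 1" by auto
  then show False unfolding k_R_def using real_sqrt_gt_1_iff[of 2] by (simp only: norm_of_real) linarith
qed

lemma phi_R_holomorphic: "phi_R holomorphic_on \<D>"
  unfolding phi_R_def
  by (intro holomorphic_intros k_R_not_in_disc) (use one_over_k_R in auto)

text \<open>
  Clearing the denominator turns \<open>\<phi>\<close> into a polynomial relation, which carries over to power
  series without any division.
\<close>

lemma phi_R_equation: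
  fixes z :: complex
  defines "l \<equiv> complex_of_real (sqrt 2 - 1)"
  assumes "z \<in> \<D>"
  shows "phi_R z - 1 = l * z * (phi_R z - 1) + l * z + l^2 * z^2"
proof -
  define k where "k = complex_of_real k_R"
  have lk: "l * k = 1" unfolding l_def k_def by (rule one_over_k_R)
  then have k0: "k \<noteq> 0" by auto
  have kz: "k - z \<noteq> 0" unfolding k_def by (rule k_R_not_in_disc) fact
  have l: "l = 1 / k" using lk k0 by (simp add: field_simps)
  have phi: "phi_R z - 1 = z * (k + z) / (k * (k - z))"
    by (simp add: phi_R_def k_def)
  show ?thesis
    unfolding phi l using k0 kz by (simp add: divide_simps) (simp add: algebra_simps power2_eq_square)
qed

text \<open>
  The three analytic relations \<open>z f' = f P\<close>, the equation for \<open>P = \<phi> \<circ> w\<close> and \<open>f \<circ> g = id\<close> hold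
  near \<open>0\<close>, hence as identities of power series, where the formal computations apply.
\<close>

lemma inverse_coeffs_formulas:
  fixes W :: "complex fps"
  defines "l \<equiv> complex_of_real (sqrt 2 - 1)"
  assumes f: "f \<in> class_A" "\<And>z. z \<in> \<D> - {0} \<Longrightarrow> f z \<noteq> 0"
    and w: "w holomorphic_on \<D>" "w ` \<D> \<subseteq> \<D>" "w 0 = 0"
    and sub: "\<And>z. z \<in> \<D> \<Longrightarrow> starlike_quotient f z = phi_R (w z)"
    and W: "w has_fps_expansion W"
    and A: "inverse_coeffs f A"
  shows "A 2 = - l * W $ 1"
    and "A 3 = - l / 2 * (W $ 2 - l * (W $ 1) ^ 2)"
    and "A 4 = - l / 3 * (W $ 3 - 2 * l * W $ 1 * W $ 2 - 2 * l ^ 2 * (W $ 1) ^ 3)"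
    and "A 5 = - l / 4 * (W $ 4 - 8 / 3 * l * W $ 1 * W $ 3 - 1 / 2 * l * (W $ 2) ^ 2
           - 17 / 3 * l ^ 2 * (W $ 1) ^ 2 * W $ 2 + 47 / 6 * l ^ 3 * (W $ 1) ^ 4)"
proof -
  define F where "F = fps_expansion f 0"
  define p where "p z = phi_R (w z)" for z
  define P where "P = fps_expansion p 0"
  have fhol: "f holomorphic_on \<D>" and f0: "f 0 = 0" using f by (auto simp: class_A_def)
  have F: "f has_fps_expansion F"
    unfolding F_def using fhol by (intro has_fps_expansion_fps_expansion[of \<D>]) auto
  have "p holomorphic_on \<D>"
    using holomorphic_on_compose_gen[OF w(1) phi_R_holomorphic w(2)] by (simp add: o_def p_def[abs_def])
  then have P: "p has_fps_expansion P"
    unfolding P_def by (intro has_fps_expansion_fps_expansion[of \<D>]) auto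
  have W0: "W $ 0 = 0"
    using has_fps_expansion_imp_0_eq_fps_nth_0[OF W] w(3) by simp
  have disc: "eventually (\<lambda>z. z \<in> \<D>) (nhds (0::complex))"
    by (intro eventually_nhds_in_open) auto

  \<comment> \<open>At \<open>z = 0\<close>, where the quotient is \<open>1\<close> by convention, both sides vanish.\<close>
  have "eventually (\<lambda>z. z * deriv f z = f z * p z) (nhds 0)"
    using disc
  proof eventually_elim
    case (elim z)
    show ?case
    proof (cases "z = 0")
      case False
      then have "z * deriv f z / f z = p z" "f z \<noteq> 0"
        using sub[OF elim] f(2)[of z] elim by (auto simp: starlike_quotient_def p_def)
      then show ?thesis by (simp add: field_simps)
    qed (simp add: f0)
  qed
  moreover have "(\<lambda>z. z * deriv f z) has_fps_expansion fps_X * fps_deriv F"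
    by (intro fps_expansion_intros F)
  ultimately have "(\<lambda>z. f z * p z) has_fps_expansion fps_X * fps_deriv F"
    by (subst (asm) has_fps_expansion_cong) auto
  moreover have "(\<lambda>z. f z * p z) has_fps_expansion F * P"
    by (intro fps_expansion_intros F P)
  ultimately have quot: "fps_X * fps_deriv F = F * P"
    by (rule fps_expansion_unique_complex)

  have "eventually (\<lambda>z. p z - 1 = l * w z * (p z - 1) + l * w z + l^2 * w z ^ 2) (nhds 0)"
    using disc
  proof eventually_elim
    case (elim z)
    then have "w z \<in> \<D>" using w(2) by blast
    then show ?case unfolding p_def l_def by (rule phi_R_equation)
  qed
  moreover have "(\<lambda>z. p z - 1) has_fps_expansion P - 1"
    by (intro fps_expansion_intros P)
  ultimately have "(\<lambda>z. l * w z * (p z - 1) + l * w z + l^2 * w z ^ 2) has_fps_expansion P - 1"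
    by (subst (asm) has_fps_expansion_cong) auto
  moreover have "(\<lambda>z. l * w z * (p z - 1) + l * w z + l^2 * w z ^ 2) has_fps_expansion
      fps_const l * W * (P - 1) + fps_const l * W + fps_const (l^2) * W ^ 2"
    by (intro fps_expansion_intros P W)
  ultimately have Peq: "P - 1 = fps_const l * W * (P - 1) + fps_const l * W + fps_const (l^2) * W ^ 2"
    by (rule fps_expansion_unique_complex)

  obtain g where g: "local_inverse_at_0 f g"
    and gA: "eventually (\<lambda>\<omega>. (\<lambda>n. A (n + 2) * \<omega> ^ (n + 2)) sums (g \<omega> - \<omega>)) (nhds 0)"
    using A unfolding inverse_coeffs_def by blast
  define G where "G = Abs_fps (\<lambda>n. if n = 0 then 0 else if n = 1 then 1 else A n)"
  have G: "g has_fps_expansion G"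
  proof (rule has_fps_expansionI, use gA in eventually_elim)
    case (elim \<omega>)
    have "(\<lambda>n. G $ (n + 2) * \<omega> ^ (n + 2)) sums (g \<omega> - (\<Sum>n<2. G $ n * \<omega> ^ n))"
      using elim by (simp add: G_def numeral_2_eq_2)
    then show ?case by (subst (asm) sums_iff_shift) simp
  qed
  have G0: "G $ 0 = 0" and G1: "G $ 1 = 1" by (simp_all add: G_def)
  have "(f \<circ> g) has_fps_expansion (F oo G)"
    by (rule has_fps_expansion_compose[OF F G G0])
  moreover have "eventually (\<lambda>\<omega>. (f \<circ> g) \<omega> = \<omega>) (nhds 0)"
    using g unfolding local_inverse_at_0_def by (auto elim: eventually_mono)
  ultimately have "(\<lambda>\<omega>. \<omega>) has_fps_expansion (F oo G)"
    by (subst (asm) has_fps_expansion_cong) auto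
  then have inv: "F oo G = fps_X"
    by (rule fps_expansion_unique_complex) (rule has_fps_expansion_fps_X)

  note Gc = fps_inverse_coeffs_of_quotient[OF fps_inverse_quotient_equation[OF inv quot G0] G0 G1]
  note Pc = fps_quotient_coeffs_of_schwarz[OF Peq W0]
  have AG: "A 2 = G $ 2" "A 3 = G $ 3" "A 4 = G $ 4" "A 5 = G $ 5"
    by (simp_all add: G_def)
  show "A 2 = - l * W $ 1"
    unfolding AG(1) Gc(2) Pc(1) by (rule mult_minus_left[symmetric])
  show "A 3 = - l / 2 * (W $ 2 - l * (W $ 1) ^ 2)"
    unfolding AG Gc Pc by (simp add: field_simps power2_eq_square)
  show "A 4 = - l / 3 * (W $ 3 - 2 * l * W $ 1 * W $ 2 - 2 * l ^ 2 * (W $ 1) ^ 3)"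
    unfolding AG Gc Pc by (simp add: field_simps power2_eq_square power3_eq_cube)
  show "A 5 = - l / 4 * (W $ 4 - 8 / 3 * l * W $ 1 * W $ 3 - 1 / 2 * l * (W $ 2) ^ 2
           - 17 / 3 * l ^ 2 * (W $ 1) ^ 2 * W $ 2 + 47 / 6 * l ^ 3 * (W $ 1) ^ 4)"
    unfolding AG Gc Pc by (simp add: field_simps power2_eq_square power3_eq_cube power4_eq_xxxx)
qed

section \<open>Coefficient bounds\<close>

lemma starlike_R_inverse_coeff_bounds:
  assumes f: "f \<in> starlike_R" and A: "inverse_coeffs f A"
  shows "cmod (A 2) \<le> sqrt 2 - 1" "cmod (A 3) \<le> (sqrt 2 - 1) / 2" "cmod (A 4) \<le> (sqrt 2 - 1) / 3"
    "cmod (A 5) \<le> 69 / sqrt 2 - 387 / 8"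
proof -
  define l where "l = sqrt 2 - 1"
  note p = silver_powers[OF l_def]
  obtain w where w: "w holomorphic_on \<D>" "w ` \<D> \<subseteq> \<D>" "w 0 = 0"
    and sub: "\<And>z. z \<in> \<D> \<Longrightarrow> starlike_quotient f z = phi_R (w z)"
    using f unfolding starlike_R_def subordinate_def by blast
  define W where "W = fps_expansion w 0"
  have W: "w has_fps_expansion W"
    unfolding W_def using w by (intro has_fps_expansion_fps_expansion[of \<D>]) auto
  have f': "f \<in> class_A" "\<And>z. z \<in> \<D> - {0} \<Longrightarrow> f z \<noteq> 0"
    using f by (auto simp: starlike_R_def)
  note formulas = inverse_coeffs_formulas[OF f' w sub W A, folded l_def]
  have scale: "cmod y \<le> l / numeral d * b"
    if "y = - complex_of_real l / numeral d * x" "cmod x \<le> b" for x y b d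
    using that p(4) by (simp add: norm_mult norm_divide divide_right_mono mult_left_mono)
  have "cmod (A 2) = l * cmod (W $ 1)"
    using formulas(1) p(4) by (simp add: norm_mult)
  also have "\<dots> \<le> l"
    using schwarz_coeff_le_1[OF w(1,2) W, of 1] p(4) by (intro mult_left_le) auto
  finally show "cmod (A 2) \<le> sqrt 2 - 1"
    by (simp only: l_def)
  have "cmod (W $ 2 - of_real l * (W $ 1) ^ 2) \<le> 1"
    by (rule schwarz_functional_2[OF w W]) (use p in auto)
  from scale[OF formulas(2) this] show "cmod (A 3) \<le> (sqrt 2 - 1) / 2"
    by (simp only: l_def mult_1_right)
  have "cmod (W $ 3 - 2 * of_real l * W $ 1 * W $ 2 - 2 * of_real l ^ 2 * (W $ 1) ^ 3) \<le> 1"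
    by (rule schwarz_functional_3[OF w W]) (use p in auto)
  from scale[OF formulas(3) this] show "cmod (A 4) \<le> (sqrt 2 - 1) / 3"
    by (simp only: l_def mult_1_right)
  have "0 \<le> l" using p by simp
  from order_trans[OF scale[OF formulas(4) schwarz_functional_4[OF w(1,2) W this]] fifth_coefficient_constant[OF l_def]]
  show "cmod (A 5) \<le> 69 / sqrt 2 - 387 / 8" .
qed

section \<open>Extremal functions\<close>

lemma inverse_coeffs_exist:
  assumes f: "f \<in> class_A"
  shows "\<exists>A. inverse_coeffs f A"
proof -
  have fhol: "f holomorphic_on \<D>" and f0: "f 0 = 0" and df: "deriv f 0 = 1"
    using f by (auto simp: class_A_def)
  obtain r where r: "r > 0" "ball 0 r \<subseteq> \<D>" and inj: "inj_on f (ball 0 r)"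
    using has_complex_derivative_locally_injective[OF fhol, of 0] df by auto
  have fr: "f holomorphic_on ball 0 r"
    using fhol r(2) by (rule holomorphic_on_subset)
  obtain g where g: "g holomorphic_on (f ` ball 0 r)"
      and dg: "\<And>z. z \<in> ball 0 r \<Longrightarrow> deriv f z * deriv g (f z) = 1"
      and gf: "\<And>z. z \<in> ball 0 r \<Longrightarrow> g (f z) = z"
    using holomorphic_has_inverse[OF fr open_ball inj] by blast
  have opn: "open (f ` ball 0 r)"
    by (rule open_mapping_thm3[OF fr open_ball inj])
  have mem: "0 \<in> f ` ball 0 r"
    using r(1) f0 by (intro image_eqI[of _ _ 0]) auto
  have g0: "g 0 = 0" and dg0: "deriv g 0 = 1"
    using gf[of 0] dg[of 0] r(1) f0 df by auto
  have "eventually (\<lambda>\<omega>. \<omega> \<in> f ` ball 0 r) (nhds 0)"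
    by (rule eventually_nhds_in_open[OF opn mem])
  then have "eventually (\<lambda>\<omega>. g \<omega> \<in> \<D> \<and> f (g \<omega>) = \<omega>) (nhds 0)"
    by eventually_elim (use gf r(2) in auto)
  moreover have "eventually (\<lambda>z. z \<in> ball 0 r) (nhds (0::complex))"
    using r(1) by (intro eventually_nhds_in_open) auto
  then have "eventually (\<lambda>z. g (f z) = z) (nhds 0)"
    by eventually_elim (rule gf)
  ultimately have loc: "local_inverse_at_0 f g"
    unfolding local_inverse_at_0_def using g0 by blast
  obtain e where e: "e > 0" "ball 0 e \<subseteq> f ` ball 0 r"
    using opn mem by (auto simp: open_contains_ball)
  define A where "A n = (deriv ^^ n) g 0 / fact n" for n
  have "eventually (\<lambda>\<omega>. \<omega> \<in> ball 0 e) (nhds (0::complex))"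
    using e(1) by (intro eventually_nhds_in_open) auto
  then have "eventually (\<lambda>\<omega>. (\<lambda>n. A (n + 2) * \<omega> ^ (n + 2)) sums (g \<omega> - \<omega>)) (nhds 0)"
  proof eventually_elim
    case (elim \<omega>)
    have "(\<lambda>n. A n * (\<omega> - 0) ^ n) sums g \<omega>"
      unfolding A_def by (rule holomorphic_power_series[OF holomorphic_on_subset[OF g e(2)] elim])
    from sums_split_initial_segment[OF this, of 2]
    have "(\<lambda>n. A (n + 2) * \<omega> ^ (n + 2)) sums (g \<omega> - (\<Sum>n<2. A n * \<omega> ^ n))"
      by (simp only: diff_zero)
    then show ?case
      by (simp add: numeral_2_eq_2 A_def g0 dg0)
  qed
  then have "inverse_coeffs f A"
    unfolding inverse_coeffs_def using loc by blast
  then show ?thesis by blast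
qed

text \<open>
  With \<open>u = z\<^sup>m\<close>, the equation \<open>z f' / f = \<phi>(u)\<close> integrates to
  \<open>log (f / z) = \<integral> (\<phi>(z\<^sup>m) - 1) / z dz = (- l u - 2 log (1 - l u)) / m\<close>, because
  \<open>(\<phi>(u) - 1) / u = l (1 + l u) / (1 - l u) = - l + 2 l / (1 - l u)\<close>. The principal logarithm is
  holomorphic here, as \<open>\<bar>l u\<bar> < 1\<close>.
\<close>

lemma starlike_R_with_power_schwarz:
  fixes m :: nat
  assumes m: "m > 0"
  obtains f where "f \<in> class_A" "\<And>z. z \<in> \<D> - {0} \<Longrightarrow> f z \<noteq> 0"
    "\<And>z. z \<in> \<D> \<Longrightarrow> starlike_quotient f z = phi_R (z ^ m)"
proof -
  define l where "l = complex_of_real (sqrt 2 - 1)"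
  define h where "h z = (- l * z ^ m - 2 * Ln (1 - l * z ^ m)) / of_nat m" for z
  define f where "f z = z * exp (h z)" for z
  have nl: "cmod l < 1"
    unfolding l_def norm_of_real using silver_powers(4,5)[OF refl] by simp
  have pos: "Re (1 - l * z ^ m) > 0" if "z \<in> \<D>" for z
  proof -
    have "cmod (z ^ m) \<le> 1" using that by (simp add: norm_power power_le_one)
    then have "cmod (l * z ^ m) < 1"
      using nl by (simp add: norm_mult) (meson le_less_trans mult_left_le norm_ge_zero)
    then have "Re (l * z ^ m) < 1"
      using complex_Re_le_cmod[of "l * z ^ m"] by linarith
    then show ?thesis by simp
  qed
  have nonpos: "1 - l * z ^ m \<notin> \<real>\<^sub>\<le>\<^sub>0" "1 - l * z ^ m \<noteq> 0" if "z \<in> \<D>" for z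
    using pos[OF that] by (auto simp: complex_nonpos_Reals_iff dest: arg_cong[of _ _ Re])
  have dh: "(h has_field_derivative
      (- l * (of_nat m * z ^ (m - 1)) - 2 * (- l * (of_nat m * z ^ (m - 1)) / (1 - l * z ^ m))) / of_nat m) (at z)"
    if "z \<in> \<D>" for z
    unfolding h_def using m nonpos[OF that]
    by (auto intro!: derivative_eq_intros simp: field_simps)
  have df: "(f has_field_derivative exp (h z) * phi_R (z ^ m)) (at z)" if z: "z \<in> \<D>" for z
  proof -
    define u where "u = z ^ m"
    have u: "u \<in> \<D>" "1 - l * u \<noteq> 0"
      using z m nonpos[OF z] by (auto simp: u_def norm_power power_less_one_iff)
    have zu: "z * z ^ (m - 1) = u" using m by (simp add: u_def power_eq_if)
    have "phi_R u - 1 = l * u * (phi_R u - 1) + l * u + l^2 * u^2"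
      unfolding l_def by (rule phi_R_equation) fact
    then have "(phi_R u - 1) * (1 - l * u) = l * u * (1 + l * u)"
      by (simp add: algebra_simps power2_eq_square)
    then have phi: "phi_R u = 1 + (- l * u - 2 * (- l * u / (1 - l * u)))"
      using u(2) by (simp add: field_simps)
    have "z * ((- l * (of_nat m * z ^ (m - 1)) - 2 * (- l * (of_nat m * z ^ (m - 1)) / (1 - l * z ^ m))) / of_nat m)
        = - l * (z * z ^ (m - 1)) - 2 * (- l * (z * z ^ (m - 1)) / (1 - l * z ^ m))"
      using m nonpos(2)[OF z] by (simp add: field_simps)
    also have "\<dots> = phi_R u - 1"
      unfolding zu phi by (simp add: u_def)
    finally have eq: "z * ((- l * (of_nat m * z ^ (m - 1)) - 2 * (- l * (of_nat m * z ^ (m - 1)) / (1 - l * z ^ m))) / of_nat m)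
        = phi_R u - 1" .
    have "(f has_field_derivative exp (h z) * (1 + z * ((- l * (of_nat m * z ^ (m - 1))
            - 2 * (- l * (of_nat m * z ^ (m - 1)) / (1 - l * z ^ m))) / of_nat m))) (at z)"
      unfolding f_def[abs_def]
      by (rule derivative_eq_intros refl dh z)+ (simp add: algebra_simps)
    then show ?thesis unfolding eq by (simp add: u_def)
  qed
  show ?thesis
  proof
    have "f holomorphic_on \<D>"
      using df unfolding holomorphic_on_open[OF open_ball] by blast
    moreover have "deriv f 0 = 1"
      using DERIV_imp_deriv[OF df[of 0]] m by (simp add: h_def phi_R_def zero_power)
    ultimately show "f \<in> class_A"
      by (simp add: class_A_def f_def)
    show "f z \<noteq> 0" if "z \<in> \<D> - {0}" for z
      using that by (simp add: f_def)
    show "starlike_quotient f z = phi_R (z ^ m)" if "z \<in> \<D>" for z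
    proof (cases "z = 0")
      case True
      then show ?thesis using m by (simp add: starlike_quotient_def phi_R_def)
    next
      case False
      then show ?thesis
        using DERIV_imp_deriv[OF df[OF that]] by (simp add: starlike_quotient_def f_def)
    qed
  qed
qed

text \<open>
  For \<open>w(z) = z\<^sup>n\<^sup>-\<^sup>1\<close> the only term that survives in the formula for \<open>A\<^sub>n\<close> is the linear one,
  \<open>c\<^sub>n\<^sub>-\<^sub>1 = 1\<close>.
\<close>

lemma starlike_R_inverse_coeff_sharp:
  assumes n: "n \<in> {2, 3, 4}"
  shows "\<exists>f A. f \<in> starlike_R \<and> inverse_coeffs f A \<and> cmod (A n) = (sqrt 2 - 1) / (real n - 1)"
proof -
  have m: "n - 1 > 0" using n by auto
  obtain f where f: "f \<in> class_A" "\<And>z. z \<in> \<D> - {0} \<Longrightarrow> f z \<noteq> 0"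
    and sub: "\<And>z. z \<in> \<D> \<Longrightarrow> starlike_quotient f z = phi_R (z ^ (n - 1))"
    using starlike_R_with_power_schwarz[OF m] by blast
  obtain A where A: "inverse_coeffs f A"
    using inverse_coeffs_exist[OF f(1)] by blast
  define w :: "complex \<Rightarrow> complex" where "w z = z ^ (n - 1)" for z
  have w: "w holomorphic_on \<D>" "w ` \<D> \<subseteq> \<D>" "w 0 = 0"
    using m by (auto simp: w_def[abs_def] norm_power power_less_one_iff intro!: holomorphic_intros)
  have sub': "starlike_quotient f z = phi_R (w z)" if "z \<in> \<D>" for z
    using sub[OF that] by (simp add: w_def)
  have "(phi_R \<circ> w) holomorphic_on \<D>"
    by (rule holomorphic_on_compose_gen[OF w(1) phi_R_holomorphic w(2)])
  then have "starlike_quotient f holomorphic_on \<D>"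
    by (rule holomorphic_transform) (simp add: sub')
  then have "f \<in> starlike_R"
    unfolding starlike_R_def subordinate_def using f phi_R_holomorphic w sub' by blast
  moreover have W: "w has_fps_expansion fps_X ^ (n - 1)"
    unfolding w_def by (rule has_fps_expansion_fps_X_power)
  note formulas = inverse_coeffs_formulas[where f = f and w = w, OF f w sub' W A]
  have "cmod (complex_of_real (sqrt 2 - 1)) = sqrt 2 - 1"
    unfolding norm_of_real by simp
  then have "cmod (A n) = (sqrt 2 - 1) / (real n - 1)"
    using n formulas by (auto simp: norm_mult norm_divide simp del: of_real_diff)
  ultimately show ?thesis using A by blast
qed

theorem theorem2p6:
  shows "(\<forall>f A. f \<in> starlike_R \<and> inverse_coeffs f A \<longrightarrow>
            (\<forall>n\<in>{2,3,4::nat}. cmod (A n) \<le> (sqrt 2 - 1) / (real n - 1)) \<and>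
            cmod (A 5) \<le> 69 / sqrt 2 - 387 / 8) \<and>
         (\<forall>n\<in>{2,3,4::nat}. \<exists>f A. f \<in> starlike_R \<and> inverse_coeffs f A \<and>
            cmod (A n) = (sqrt 2 - 1) / (real n - 1))"
  using starlike_R_inverse_coeff_bounds starlike_R_inverse_coeff_sharp by auto

end
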